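(* Let $(\overline{\mathfrak{g}},\overline\alpha,\overline\omega)$ be a cosymplectic Lie algebra with Reeb vector $\overline\xi$ and bracket $\overline{[\,,\,]}$. Let $\varphi\in\mathrm{Der}(\overline{\mathfrak{g}})$ and $v\in\overline{\mathfrak{g}}$, and let $\mathfrak{g}=\langle d\rangle\oplus\overline{\mathfrak{g}}\oplus\langle e\rangle$ be equipped with the alternating bilinear bracket of the double extension of $\overline{\mathfrak{g}}$ by $(D,\theta=0)$ with $D=(\varphi,\overline\alpha\circ\varphi,v,\overline\alpha(v))$, that is, $$[x,y]=\overline{[x,y]},\quad [x,e]=0,\quad [d,x]=\varphi(x)+\overline\alpha(\varphi(x))e,\quad [d,e]=v+\overline\alpha(v)e,\qquad x,y\in\overline{\mathfrak{g}}.$$ Let $\omega=\overline\omega+d^*\wedge e^*$ and let $\alpha\in\mathfrak{g}^*$ be such that $\alpha(x)=\overline\alpha(x)$ for all $x\in\overline{\mathfrak{g}}$, $\alpha(d)\in\mathbb{R}$ is arbitrary, and $\alpha(e)=-1$. Then $(\alpha,\omega)$ defines a cosymplectic structure on $\mathfrak{g}$ (i.e. the bracket is a Lie bracket and $(\mathfrak{g},\alpha,\omega)$ is a cosymplectic Lie algebra) if and only if 1. $\overline\omega_\varphi=0$; 2. $\overline\alpha\circ\varphi(\overline{[x,y]})=0$ for all $x,y\in\overline{\mathfrak{g}}$; 3. $v\in Z(\overline{\mathfrak{g}})\cap\ker(\overline\omega)$. Also, the Reeb vector is $\overline\xi$.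
   Context: A cosymplectic Lie algebra $(\mathfrak{g},\alpha,\omega)$ is a real Lie algebra of dimension $2n+1$ with $\alpha\in\mathfrak{g}^*$ and $\omega\in\wedge^2\mathfrak{g}^*$ such that $\alpha([x,y])=0$, $\omega([x,y],z)+\omega([y,z],x)+\omega([z,x],y)=0$ for all $x,y,z$, and $\alpha\wedge\omega^n\neq0$. Its Reeb vector $\xi$ is the unique vector with $\alpha(\xi)=1$, $\iota_\xi\omega=0$. Notation: $\overline\omega_\varphi(x,y)=\overline\omega(\varphi(x),y)+\overline\omega(x,\varphi(y))$; $\ker(\overline\omega)=\{x\in\overline{\mathfrak{g}}:\overline\omega(x,y)=0\ \forall y\in\overline{\mathfrak{g}}\}$; $Z(\overline{\mathfrak{g}})$ is the center; $\mathrm{Der}(\overline{\mathfrak{g}})$ is the space of derivations. The form $\overline\omega$ is extended to $\langle d\rangle\oplus\overline{\mathfrak{g}}\oplus\langle e\rangle$ by zero on $d,e$, and $d^*,e^*$ are the linear forms dual to $d,e$ vanishing on the other summands. *)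

theory Defs
  imports "HOL-Analysis.Analysis" "HOL-Combinatorics.Permutations"
begin

subsection \<open>Exterior forms\<close>

text \<open>
  A k-form on a real vector space is represented as a function of a sequence of vectors
  that only inspects the entries with index below k.
\<close>

type_synonym 'a form = "(nat \<Rightarrow> 'a) \<Rightarrow> real"

definition wedge :: "nat \<Rightarrow> nat \<Rightarrow> 'a form \<Rightarrow> 'a form \<Rightarrow> 'a form" where
  "wedge k l \<eta> \<zeta> = (\<lambda>u.
     (\<Sum>\<sigma> | \<sigma> permutes {..<k + l}.
        of_int (sign \<sigma>) * \<eta> (\<lambda>i. u (\<sigma> i)) * \<zeta> (\<lambda>i. u (\<sigma> (k + i))))
     / (fact k * fact l))"

definition one_form :: "('a \<Rightarrow> real) \<Rightarrow> 'a form" where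
  "one_form \<alpha> = (\<lambda>u. \<alpha> (u 0))"

definition two_form :: "('a \<Rightarrow> 'a \<Rightarrow> real) \<Rightarrow> 'a form" where
  "two_form \<omega> = (\<lambda>u. \<omega> (u 0) (u 1))"

primrec wedge_power :: "('a \<Rightarrow> 'a \<Rightarrow> real) \<Rightarrow> nat \<Rightarrow> 'a form" where
  "wedge_power \<omega> 0 = (\<lambda>u. 1)"
| "wedge_power \<omega> (Suc n) = wedge 2 (2 * n) (two_form \<omega>) (wedge_power \<omega> n)"

subsection \<open>Lie algebras and cosymplectic structures\<close>

definition lie_bracket :: "('a::real_vector \<Rightarrow> 'a \<Rightarrow> 'a) \<Rightarrow> bool" where
  "lie_bracket br \<longleftrightarrow>
     bilinear br \<and> (\<forall>x. br x x = 0) \<and>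
     (\<forall>x y z. br x (br y z) + br y (br z x) + br z (br x y) = 0)"

definition derivation :: "('a::real_vector \<Rightarrow> 'a \<Rightarrow> 'a) \<Rightarrow> ('a \<Rightarrow> 'a) \<Rightarrow> bool" where
  "derivation br \<phi> \<longleftrightarrow>
     linear \<phi> \<and> (\<forall>x y. \<phi> (br x y) = br (\<phi> x) y + br x (\<phi> y))"

definition lie_center :: "('a::real_vector \<Rightarrow> 'a \<Rightarrow> 'a) \<Rightarrow> 'a set" where
  "lie_center br = {x. \<forall>y. br x y = 0}"

definition form_kernel :: "('a \<Rightarrow> 'a \<Rightarrow> real) \<Rightarrow> 'a set" where
  "form_kernel \<omega> = {x. \<forall>y. \<omega> x y = 0}"

definition form_deriv :: "('a \<Rightarrow> 'a \<Rightarrow> real) \<Rightarrow> ('a \<Rightarrow> 'a) \<Rightarrow> 'a \<Rightarrow> 'a \<Rightarrow> real" where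
  "form_deriv \<omega> \<phi> x y = \<omega> (\<phi> x) y + \<omega> x (\<phi> y)"

text \<open>
  The condition on \<^term>\<open>dim\<close> includes finite dimensionality, since \<^term>\<open>dim\<close> is 0 on
  infinite-dimensional spaces.
\<close>

definition cosymplectic ::
  "('a::real_vector \<Rightarrow> 'a \<Rightarrow> 'a) \<Rightarrow> ('a \<Rightarrow> real) \<Rightarrow> ('a \<Rightarrow> 'a \<Rightarrow> real) \<Rightarrow> bool" where
  "cosymplectic br \<alpha> \<omega> \<longleftrightarrow>
     lie_bracket br \<and>
     linear \<alpha> \<and> bilinear \<omega> \<and> (\<forall>x. \<omega> x x = 0) \<and>
     (\<forall>x y. \<alpha> (br x y) = 0) \<and>
     (\<forall>x y z. \<omega> (br x y) z + \<omega> (br y z) x + \<omega> (br z x) y = 0) \<and>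
     (\<exists>n. dim (UNIV :: 'a set) = 2 * n + 1 \<and>
          wedge 1 (2 * n) (one_form \<alpha>) (wedge_power \<omega> n) \<noteq> (\<lambda>u. 0))"

definition is_reeb_vector ::
  "('a::real_vector \<Rightarrow> real) \<Rightarrow> ('a \<Rightarrow> 'a \<Rightarrow> real) \<Rightarrow> 'a \<Rightarrow> bool" where
  "is_reeb_vector \<alpha> \<omega> \<xi> \<longleftrightarrow>
     \<alpha> \<xi> = 1 \<and> (\<forall>y. \<omega> \<xi> y = 0) \<and>
     (\<forall>\<zeta>. \<alpha> \<zeta> = 1 \<and> (\<forall>y. \<omega> \<zeta> y = 0) \<longrightarrow> \<zeta> = \<xi>)"

subsection \<open>Double extensions\<close>

text \<open>
  The direct sum of the line spanned by d, the space \<^typ>\<open>'a\<close> and the line spanned by e is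
  the product \<^typ>\<open>real \<times> 'a \<times> real\<close>: the triple (s, x, t) stands for s d + x + t e.
\<close>

definition ext_d :: "real \<times> 'a::real_vector \<times> real" where
  "ext_d = (1, 0, 0)"

definition ext_e :: "real \<times> 'a::real_vector \<times> real" where
  "ext_e = (0, 0, 1)"

definition ext_in :: "'a \<Rightarrow> real \<times> 'a \<times> real" where
  "ext_in x = (0, x, 0)"

definition ext_proj :: "real \<times> 'a \<times> real \<Rightarrow> 'a" where
  "ext_proj X = fst (snd X)"

definition ext_d_dual :: "real \<times> 'a \<times> real \<Rightarrow> real" where
  "ext_d_dual X = fst X"

definition ext_e_dual :: "real \<times> 'a \<times> real \<Rightarrow> real" where
  "ext_e_dual X = snd (snd X)"

text \<open>
  The bracket of the double extension by \<open>(D, \<theta> = 0)\<close> with \<open>D = (\<phi>, \<delta>, v, c)\<close>: the alternating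
  bilinear map determined by the values in lemma \<open>ext_bracket_values\<close> below.
\<close>

definition ext_bracket ::
  "('a::real_vector \<Rightarrow> 'a \<Rightarrow> 'a) \<Rightarrow> ('a \<Rightarrow> 'a) \<Rightarrow> ('a \<Rightarrow> real) \<Rightarrow> 'a \<Rightarrow> real
     \<Rightarrow> real \<times> 'a \<times> real \<Rightarrow> real \<times> 'a \<times> real \<Rightarrow> real \<times> 'a \<times> real" where
  "ext_bracket br \<phi> \<delta> v c = (\<lambda>(s, x, t) (s', x', t').
     (0,
      br x x' + s *\<^sub>R \<phi> x' - s' *\<^sub>R \<phi> x + (s * t' - s' * t) *\<^sub>R v,
      s * \<delta> x' - s' * \<delta> x + (s * t' - s' * t) * c))"

lemma ext_bracket_values:
  assumes "bilinear br" "linear \<phi>" "linear \<delta>"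
  shows "ext_bracket br \<phi> \<delta> v c (ext_in x) (ext_in y) = ext_in (br x y)"
    and "ext_bracket br \<phi> \<delta> v c (ext_in x) ext_e = 0"
    and "ext_bracket br \<phi> \<delta> v c ext_d (ext_in x) = ext_in (\<phi> x) + \<delta> x *\<^sub>R ext_e"
    and "ext_bracket br \<phi> \<delta> v c ext_d ext_e = ext_in v + c *\<^sub>R ext_e"
  using assms
  by (simp_all add: ext_bracket_def ext_in_def ext_d_def ext_e_def bilinear_lzero bilinear_rzero
      linear_0 zero_prod_def)

lemma ext_bracket_alternating:
  assumes "\<And>x. br x x = 0"
  shows "ext_bracket br \<phi> \<delta> v c X X = 0"
  using assms by (cases X) (simp add: ext_bracket_def zero_prod_def)

lemma ext_bracket_bilinear:
  assumes "bilinear br" "linear \<phi>" "linear \<delta>"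
  shows "bilinear (ext_bracket br \<phi> \<delta> v c)"
  unfolding bilinear_def
  by (intro conjI allI linearI;
      clarsimp simp: ext_bracket_def assms bilinear_ladd bilinear_radd bilinear_lmul
        bilinear_rmul linear_add linear_scale algebra_simps)

definition ext_form ::
  "('a \<Rightarrow> 'a \<Rightarrow> real) \<Rightarrow> real \<times> 'a \<times> real \<Rightarrow> real \<times> 'a \<times> real \<Rightarrow> real" where
  "ext_form \<omega> X Y =
     \<omega> (ext_proj X) (ext_proj Y) +
     (ext_d_dual X * ext_e_dual Y - ext_d_dual Y * ext_e_dual X)"

end

theory Submission
  imports Defs
begin

text \<open>
  Expanding the Jacobi identity and the cocycle condition in the decomposition of the extension
  yields exactly the three conditions; it remains to see that \<open>\<alpha> \<and> \<omega>\<^sup>n\<close> stays nonzero. Written as a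
  signed sum over permutations, its value at \<open>(u\<^sub>0, \<dots>, u\<^sub>2\<^sub>n, d, e)\<close> only receives contributions
  from permutations that pair \<open>d\<close> with \<open>e\<close> inside a factor \<open>\<omega>\<close>. There are \<open>2 (n + 1)\<close> ways to place
  that pair, and each contributes the signed sum of \<open>(u\<^sub>0, \<dots>, u\<^sub>2\<^sub>n)\<close>.
\<close>

subsection \<open>The top form as a signed sum\<close>

text \<open>A permutation \<tau> of the last \<open>l\<close> positions can be absorbed into
  \<sigma> by composition; \<eta> reads only the first \<open>k\<close> positions and does not
  notice. Each of the \<open>fact l\<close> choices of \<tau> therefore gives the same sum, which
  cancels the factor \<open>1 / fact l\<close> in \<open>wedge\<close>. In this way an iterated
  wedge collapses to a single signed sum.\<close>

lemma wedge_signed_sum: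
  fixes \<eta> \<zeta> P :: "'a form"
  assumes \<eta>: "\<And>u u'. (\<And>i. i < k \<Longrightarrow> u i = u' i) \<Longrightarrow> \<eta> u = \<eta> u'"
    and \<zeta>: "\<And>u. \<zeta> u = c * (\<Sum>\<tau> | \<tau> permutes {..<l}. of_int (sign \<tau>) * P (\<lambda>i. u (\<tau> i)))"
  shows "wedge k l \<eta> \<zeta> u = c / fact k *
    (\<Sum>\<sigma> | \<sigma> permutes {..<k + l}.
      of_int (sign \<sigma>) * \<eta> (\<lambda>i. u (\<sigma> i)) * P (\<lambda>i. u (\<sigma> (k + i))))"
proof -
  let ?S = "\<Sum>\<sigma> | \<sigma> permutes {..<k + l}.
    of_int (sign \<sigma>) * \<eta> (\<lambda>i. u (\<sigma> i)) * P (\<lambda>i. u (\<sigma> (k + i)))"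
  have shift: "(\<Sum>\<sigma> | \<sigma> permutes {..<k + l}. of_int (sign \<sigma>) * of_int (sign \<tau>) *
      \<eta> (\<lambda>i. u (\<sigma> i)) * P (\<lambda>i. u (\<sigma> (k + \<tau> i)))) = ?S" if \<tau>: "\<tau> permutes {..<l}" for \<tau>
  proof -
    \<comment> \<open>\<open>q\<close> is \<tau> transported to the positions from \<open>k\<close>
      on and the identity elsewhere; the transport is injective, so the sign is kept.\<close>
    define q where "q = map_permutation {..<l} ((+) k) \<tau>"
    have bij: "bij_betw ((+) k) {..<l} {k..<k + l}"
      using bij_betw_add[of k "{..<l}" "{k..<k + l}"] by (simp add: lessThan_atLeast0 add.commute)
    have q: "q permutes {k..<k + l}"
      unfolding q_def by (rule map_permutation_permutes[OF bij \<tau>])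
    then have q': "q permutes {..<k + l}"
      by (rule permutes_subset) auto
    have sq: "sign q = sign \<tau>"
      unfolding q_def by (rule sign_map_permutation) (use \<tau> in auto)
    have q_low: "q i = i" if "i < k" for i
      using permutes_not_in[OF q] that by simp
    have q_high: "q (k + i) = k + \<tau> i" for i
    proof (cases "i < l")
      case True
      then show ?thesis
        unfolding q_def using map_permutation_apply[of "(+) k" "{..<l}" i \<tau>] by simp
    next
      case False
      then show ?thesis
        using permutes_not_in[OF q, of "k + i"] permutes_not_in[OF \<tau>, of i] by simp
    qed
    have "?S = (\<Sum>\<sigma> | \<sigma> permutes {..<k + l}. of_int (sign (\<sigma> \<circ> q)) *
        \<eta> (\<lambda>i. u ((\<sigma> \<circ> q) i)) * P (\<lambda>i. u ((\<sigma> \<circ> q) (k + i))))"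
      by (rule sum_permutations_compose_right[OF q'])
    also have "\<dots> = (\<Sum>\<sigma> | \<sigma> permutes {..<k + l}. of_int (sign \<sigma>) * of_int (sign \<tau>) *
        \<eta> (\<lambda>i. u (\<sigma> i)) * P (\<lambda>i. u (\<sigma> (k + \<tau> i))))"
    proof (rule sum.cong[OF refl], clarsimp simp only: mem_Collect_eq)
      fix \<sigma> assume "\<sigma> permutes {..<k + l}"
      then have "sign (\<sigma> \<circ> q) = sign \<sigma> * sign \<tau>"
        using sign_compose[of \<sigma> q] q' permutes_imp_permutation[of "{..<k + l}"] sq by simp
      moreover have "\<eta> (\<lambda>i. u ((\<sigma> \<circ> q) i)) = \<eta> (\<lambda>i. u (\<sigma> i))"
        by (rule \<eta>) (simp add: q_low)
      ultimately show "of_int (sign (\<sigma> \<circ> q)) * \<eta> (\<lambda>i. u ((\<sigma> \<circ> q) i)) *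
          P (\<lambda>i. u ((\<sigma> \<circ> q) (k + i))) =
        of_int (sign \<sigma>) * of_int (sign \<tau>) * \<eta> (\<lambda>i. u (\<sigma> i)) * P (\<lambda>i. u (\<sigma> (k + \<tau> i)))"
        by (simp add: q_high)
    qed
    finally show ?thesis ..
  qed
  have "(\<Sum>\<sigma> | \<sigma> permutes {..<k + l}.
      of_int (sign \<sigma>) * \<eta> (\<lambda>i. u (\<sigma> i)) * \<zeta> (\<lambda>i. u (\<sigma> (k + i)))) =
    (\<Sum>\<sigma> | \<sigma> permutes {..<k + l}. \<Sum>\<tau> | \<tau> permutes {..<l}. c * (of_int (sign \<sigma>) *
      of_int (sign \<tau>) * \<eta> (\<lambda>i. u (\<sigma> i)) * P (\<lambda>i. u (\<sigma> (k + \<tau> i)))))"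
    by (simp add: \<zeta> sum_distrib_left mult_ac)
  also have "\<dots> = (\<Sum>\<tau> | \<tau> permutes {..<l}. c *
      (\<Sum>\<sigma> | \<sigma> permutes {..<k + l}. of_int (sign \<sigma>) * of_int (sign \<tau>) *
        \<eta> (\<lambda>i. u (\<sigma> i)) * P (\<lambda>i. u (\<sigma> (k + \<tau> i)))))"
    by (subst sum.swap) (simp add: sum_distrib_left)
  also have "\<dots> = (\<Sum>\<tau> | \<tau> permutes {..<l}. c * ?S)"
    by (rule sum.cong[OF refl]) (simp only: shift mem_Collect_eq)
  also have "\<dots> = fact l * (c * ?S)"
    by (simp add: card_permutations[of "{..<l}" l])
  finally show ?thesis
    unfolding wedge_def by simp
qed

text \<open>Each wedge with \<omega> leaves only its own \<open>1 / fact 2\<close>, the factorial of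
  the other degree being cancelled; hence the constant \<open>1 / 2 ^ n\<close>.\<close>

lemma wedge_power_signed_sum:
  "wedge_power \<omega> n u = (1 / 2 ^ n) *
    (\<Sum>\<sigma> | \<sigma> permutes {..<2 * n}. of_int (sign \<sigma>) *
      (\<Prod>i<n. \<omega> (u (\<sigma> (2 * i))) (u (\<sigma> (2 * i + 1)))))"
proof (induction n arbitrary: u)
  case 0
  show ?case by simp
next
  case (Suc n)
  have "wedge 2 (2 * n) (two_form \<omega>) (wedge_power \<omega> n) u = (1 / 2 ^ n) / fact 2 *
    (\<Sum>\<sigma> | \<sigma> permutes {..<2 + 2 * n}. of_int (sign \<sigma>) * two_form \<omega> (\<lambda>i. u (\<sigma> i)) *
      (\<Prod>i<n. \<omega> (u (\<sigma> (2 + 2 * i))) (u (\<sigma> (2 + (2 * i + 1))))))"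
    by (rule wedge_signed_sum[where P = "\<lambda>u. \<Prod>i<n. \<omega> (u (2 * i)) (u (2 * i + 1))"])
      (simp_all add: two_form_def Suc.IH)
  \<comment> \<open>The new factor is multiplied from the left and occupies positions 0 and 1, so
    the product is split at its first index and not at its last.\<close>
  then show ?case
    by (simp add: two_form_def prod.lessThan_Suc_shift fact_numeral mult_ac
        del: prod.lessThan_Suc)
qed

text \<open>The top form freed of its constant \<open>1 / 2 ^ n\<close>, so that it vanishes exactly
  when the top form does. Position 0 is the slot of \<alpha>; positions \<open>2 * i + 1\<close> and
  \<open>2 * i + 2\<close> are the slots of factor \<open>i\<close>.\<close>

definition signed_sum :: "('a \<Rightarrow> real) \<Rightarrow> ('a \<Rightarrow> 'a \<Rightarrow> real) \<Rightarrow> nat \<Rightarrow> 'a form" where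
  "signed_sum \<alpha> \<omega> n u = (\<Sum>\<sigma> | \<sigma> permutes {..<2 * n + 1}.
     of_int (sign \<sigma>) * \<alpha> (u (\<sigma> 0)) * (\<Prod>i<n. \<omega> (u (\<sigma> (2 * i + 1))) (u (\<sigma> (2 * i + 2)))))"

lemma wedge_eq_signed_sum:
  "wedge 1 (2 * n) (one_form \<alpha>) (wedge_power \<omega> n) u = signed_sum \<alpha> \<omega> n u / 2 ^ n"
proof -
  have "wedge 1 (2 * n) (one_form \<alpha>) (wedge_power \<omega> n) u = (1 / 2 ^ n) / fact 1 *
    (\<Sum>\<sigma> | \<sigma> permutes {..<1 + 2 * n}. of_int (sign \<sigma>) * one_form \<alpha> (\<lambda>i. u (\<sigma> i)) *
      (\<Prod>i<n. \<omega> (u (\<sigma> (1 + 2 * i))) (u (\<sigma> (1 + (2 * i + 1))))))"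
    by (rule wedge_signed_sum[where P = "\<lambda>u. \<Prod>i<n. \<omega> (u (2 * i)) (u (2 * i + 1))"])
      (simp_all add: one_form_def wedge_power_signed_sum)
  then show ?thesis
    by (simp add: one_form_def signed_sum_def)
qed

subsection \<open>Adjoining a hyperbolic pair\<close>

text \<open>The Gram matrix of \<omega> on \<open>w\<close> splits off a 2 x 2 block belonging to
  the last two entries, and the signed sum factors over the blocks as a Pfaffian does.\<close>

lemma signed_sum_hyperbolic_pair:
  fixes \<omega> :: "'a \<Rightarrow> 'a \<Rightarrow> real"
  assumes anti: "\<And>x y. \<omega> x y = - \<omega> y x"
    and orth: "\<And>i. i < 2 * n + 1 \<Longrightarrow> \<omega> (w (2 * n + 1)) (w i) = 0"
      "\<And>i. i < 2 * n + 1 \<Longrightarrow> \<omega> (w (2 * n + 2)) (w i) = 0"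
  shows "signed_sum \<alpha> \<omega> (Suc n) w =
    2 * (real n + 1) * \<omega> (w (2 * n + 1)) (w (2 * n + 2)) * signed_sum \<alpha> \<omega> n w"
proof -
  define m where "m = 2 * n + 1"
  define S where "S = {\<sigma>. \<sigma> permutes {..<m + 2}}"
  define T where "T = (\<lambda>\<sigma>. of_int (sign \<sigma>) * \<alpha> (w (\<sigma> 0)) *
    (\<Prod>i<Suc n. \<omega> (w (\<sigma> (2 * i + 1))) (w (\<sigma> (2 * i + 2)))))"
  \<comment> \<open>The last two vectors have the indices \<open>m\<close> and \<open>m + 1\<close>.
    \<open>A i\<close> collects the permutations that feed them to factor \<open>i\<close> in this
    order, \<open>B i\<close> those that feed them in the opposite order.\<close>
  define A where "A = (\<lambda>i. {\<sigma> \<in> S. \<sigma> (2 * i + 1) = m \<and> \<sigma> (2 * i + 2) = m + 1})"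
  define B where "B = (\<lambda>i. {\<sigma> \<in> S. \<sigma> (2 * i + 1) = m + 1 \<and> \<sigma> (2 * i + 2) = m})"
  have finS: "finite S"
    unfolding S_def by (rule finite_permutations) simp
  then have fin: "finite (A i)" "finite (B i)" for i
    by (auto simp: A_def B_def)
  have injS: "\<sigma> a = \<sigma> b \<longleftrightarrow> a = b" if "\<sigma> \<in> S" for \<sigma> a b
    using that permutes_inj[of \<sigma>] by (auto simp: S_def inj_eq)
  have perm: "permutation \<sigma>" if "\<sigma> \<in> S" for \<sigma>
    using that permutes_imp_permutation[of "{..<m + 2}"] by (auto simp: S_def)
  have orth': "\<omega> (w a) (w b) = 0"
    if "a \<in> {m, m + 1}" "b < m \<or> b = a" for a b
    using that orth anti[of "w a" "w a"] by (auto simp: m_def)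

  have support: "\<exists>i<Suc n. \<sigma> \<in> A i \<union> B i" if \<sigma>: "\<sigma> \<in> S" and nz: "T \<sigma> \<noteq> 0" for \<sigma>
  proof -
    have \<sigma>p: "\<sigma> permutes {..<m + 2}" using \<sigma> by (simp add: S_def)
    obtain p0 p1 where p: "\<sigma> p0 = m" "\<sigma> p1 = m + 1"
      using permutes_surj[OF \<sigma>p] by (metis surjD)
    then have "p0 \<noteq> p1" by auto
    \<comment> \<open>Two distinct positions carry \<open>m\<close> and \<open>m + 1\<close>, so one
      of them is not the slot of \<alpha> and lies in some factor \<omega>, whose number is
      \<open>(p - 1) div 2\<close>.\<close>
    with p obtain p where p: "\<sigma> p \<in> {m, m + 1}" "p \<noteq> 0"
      by (metis insertI1 insertI2)
    have "p < m + 2"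
      using permutes_in_image[OF \<sigma>p, of p] p(1) by auto
    define i where "i = (p - 1) div 2"
    have i: "i < Suc n" and pi: "p = 2 * i + 1 \<or> p = 2 * i + 2"
      using p(2) \<open>p < m + 2\<close> by (auto simp: i_def m_def)
    have nzi: "\<omega> (w (\<sigma> (2 * i + 1))) (w (\<sigma> (2 * i + 2))) \<noteq> 0"
      using nz i unfolding T_def by (auto simp del: prod.lessThan_Suc)
    have lt: "\<sigma> (2 * i + 1) < m + 2" "\<sigma> (2 * i + 2) < m + 2"
      using permutes_in_image[OF \<sigma>p] i by (auto simp: m_def)
    \<comment> \<open>If the partner of this position carried an index below \<open>m\<close>,
      orthogonality would make the factor vanish.\<close>
    have "\<sigma> (2 * i + 1) \<in> {m, m + 1} \<and> \<sigma> (2 * i + 2) \<in> {m, m + 1}"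
    proof (rule ccontr)
      assume "\<not> ?thesis"
      then have "\<sigma> (2 * i + 1) \<in> {m, m + 1} \<and> \<sigma> (2 * i + 2) < m \<or>
          \<sigma> (2 * i + 2) \<in> {m, m + 1} \<and> \<sigma> (2 * i + 1) < m"
        using pi p(1) lt by auto
      then show False
        using nzi orth' anti[of "w (\<sigma> (2 * i + 1))" "w (\<sigma> (2 * i + 2))"] by auto
    qed
    moreover have "\<sigma> (2 * i + 1) \<noteq> \<sigma> (2 * i + 2)"
      by (simp add: injS[OF \<sigma>])
    ultimately have "\<sigma> \<in> A i \<union> B i"
      using \<sigma> by (auto simp: A_def B_def)
    with i show ?thesis by blast
  qed

  have B_eq_A: "sum T (B i) = sum T (A i)" if i: "i < Suc n" for i
  proof -
    \<comment> \<open>Exchanging the two slots of factor \<open>i\<close> swaps \<open>A i\<close>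
      and \<open>B i\<close>. The sign of the permutation and the sign of that factor both change,
      so \<open>T\<close> is preserved.\<close>
    define q where "q = Transposition.transpose (2 * i + 1) (2 * i + 2)"
    have q: "q permutes {..<m + 2}"
      unfolding q_def by (rule permutes_swap_id) (use i in \<open>auto simp: m_def\<close>)
    have q1: "q (2 * i + 1) = 2 * i + 2" and q2: "q (2 * i + 2) = 2 * i + 1"
      by (simp_all add: q_def)
    have qq: "\<sigma> \<circ> q \<circ> q = \<sigma>" for \<sigma> :: "nat \<Rightarrow> nat"
      by (auto simp: q_def fun_eq_iff)
    have SS: "\<sigma> \<circ> q \<in> S" if "\<sigma> \<in> S" for \<sigma>
      using that permutes_compose[OF q] by (simp add: S_def)
    have TT: "T (\<sigma> \<circ> q) = T \<sigma>" if "\<sigma> \<in> S" for \<sigma>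
    proof -
      have "sign (\<sigma> \<circ> q) = - sign \<sigma>"
        using sign_compose[OF perm[OF that], of q] by (simp add: q_def permutation_swap_id sign_swap_id)
      moreover have "(\<sigma> \<circ> q) 0 = \<sigma> 0"
        by (simp add: q_def Transposition.transpose_def)
      moreover have "(\<Prod>j<Suc n. \<omega> (w ((\<sigma> \<circ> q) (2 * j + 1))) (w ((\<sigma> \<circ> q) (2 * j + 2)))) =
          - (\<Prod>j<Suc n. \<omega> (w (\<sigma> (2 * j + 1))) (w (\<sigma> (2 * j + 2))))"
      proof -
        have "(\<Prod>j\<in>{..<Suc n} - {i}. \<omega> (w ((\<sigma> \<circ> q) (2 * j + 1))) (w ((\<sigma> \<circ> q) (2 * j + 2)))) =
            (\<Prod>j\<in>{..<Suc n} - {i}. \<omega> (w (\<sigma> (2 * j + 1))) (w (\<sigma> (2 * j + 2))))"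
        proof (rule prod.cong[OF refl])
          fix j assume "j \<in> {..<Suc n} - {i}"
          then have "j \<noteq> i" by simp
          then have "q (2 * j + 1) = 2 * j + 1" "q (2 * j + 2) = 2 * j + 2"
            unfolding q_def Transposition.transpose_def by presburger+
          then show "\<omega> (w ((\<sigma> \<circ> q) (2 * j + 1))) (w ((\<sigma> \<circ> q) (2 * j + 2))) =
              \<omega> (w (\<sigma> (2 * j + 1))) (w (\<sigma> (2 * j + 2)))"
            by (simp only: comp_apply)
        qed
        moreover have "\<omega> (w ((\<sigma> \<circ> q) (2 * i + 1))) (w ((\<sigma> \<circ> q) (2 * i + 2))) =
            - \<omega> (w (\<sigma> (2 * i + 1))) (w (\<sigma> (2 * i + 2)))"
          by (simp add: q_def) (rule anti)
        ultimately show ?thesis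
          using i by (simp only: prod.remove[of "{..<Suc n}" i] finite_lessThan lessThan_iff
              mult_minus_left)
      qed
      ultimately show ?thesis
        by (simp only: T_def of_int_minus minus_mult_minus mult_minus_left mult_minus_right minus_minus)
    qed
    show ?thesis
      by (rule sum.reindex_bij_witness[where i = "\<lambda>\<sigma>. \<sigma> \<circ> q" and j = "\<lambda>\<sigma>. \<sigma> \<circ> q"])
        (auto simp: A_def B_def q1 q2 qq SS TT simp del: One_nat_def add_Suc_right add_2_eq_Suc')
  qed

  have A_eq_An: "sum T (A i) = sum T (A n)" if i: "i < Suc n" for i
  proof -
    \<comment> \<open>This exchanges the slots of factors \<open>i\<close> and \<open>n\<close> and
      so merely reorders the product. The two transpositions have equal signs, also for
      \<open>i = n\<close>, where both are the identity; hence \<open>q\<close> is even.\<close>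
    define q where "q = Transposition.transpose (2 * i + 1) (2 * n + 1) \<circ>
      Transposition.transpose (2 * i + 2) (2 * n + 2)"
    have q: "q permutes {..<m + 2}"
      unfolding q_def
      by (intro permutes_compose permutes_swap_id) (use i in \<open>auto simp: m_def\<close>)
    have q0: "q 0 = 0"
      and q1: "q (2 * j + 1) = 2 * Transposition.transpose i n j + 1"
      and q2: "q (2 * j + 2) = 2 * Transposition.transpose i n j + 2" for j
      unfolding q_def comp_apply Transposition.transpose_def by presburger+
    have "q (q j) = j" for j
      unfolding q_def comp_apply Transposition.transpose_def by presburger
    then have qq: "\<sigma> \<circ> q \<circ> q = \<sigma>" for \<sigma> :: "nat \<Rightarrow> nat"
      by (auto simp: fun_eq_iff)
    have SS: "\<sigma> \<circ> q \<in> S" if "\<sigma> \<in> S" for \<sigma>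
      using that permutes_compose[OF q] by (simp add: S_def)
    have TT: "T (\<sigma> \<circ> q) = T \<sigma>" if "\<sigma> \<in> S" for \<sigma>
    proof -
      have "sign q = 1"
        unfolding q_def by (subst sign_compose) (auto simp: permutation_swap_id sign_swap_id)
      then have "sign (\<sigma> \<circ> q) = sign \<sigma>"
        using sign_compose[OF perm[OF that], of q] permutes_imp_permutation[OF _ q] by simp
      moreover have "(\<Prod>j<Suc n. \<omega> (w (\<sigma> (q (2 * j + 1)))) (w (\<sigma> (q (2 * j + 2))))) =
          (\<Prod>j<Suc n. \<omega> (w (\<sigma> (2 * j + 1))) (w (\<sigma> (2 * j + 2))))"
        unfolding q1 q2
        by (rule prod.reindex_bij_betw[where h = "Transposition.transpose i n"
              and g = "\<lambda>j. \<omega> (w (\<sigma> (2 * j + 1))) (w (\<sigma> (2 * j + 2)))"])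
          (use i in \<open>auto intro: permutes_imp_bij permutes_swap_id\<close>)
      ultimately show ?thesis
        by (simp only: T_def comp_apply q0)
    qed
    show ?thesis
      by (rule sum.reindex_bij_witness[where i = "\<lambda>\<sigma>. \<sigma> \<circ> q" and j = "\<lambda>\<sigma>. \<sigma> \<circ> q"])
        (auto simp: A_def q1 q2 qq SS TT simp del: One_nat_def add_Suc_right add_2_eq_Suc')
  qed

  \<comment> \<open>Factor \<open>n\<close> serves as reference because its slots are themselves
    \<open>m\<close> and \<open>m + 1\<close>: membership in \<open>A n\<close> means fixing both,
    which leaves a permutation of the first \<open>m\<close> indices.\<close>
  have An: "A n = {\<sigma>. \<sigma> permutes {..<m}}"
  proof (intro set_eqI iffI)
    fix \<sigma> assume "\<sigma> \<in> A n"
    then have \<sigma>: "\<sigma> permutes {..<m + 2}" "\<sigma> m = m" "\<sigma> (m + 1) = m + 1"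
      by (auto simp: A_def S_def m_def)
    have "\<sigma> permutes {..<m}"
    proof (rule permutes_superset[OF \<sigma>(1)])
      fix x assume "x \<in> {..<m + 2} - {..<m}"
      then have "x = m \<or> x = m + 1" by auto
      then show "\<sigma> x = x" using \<sigma>(2,3) by blast
    qed
    then show "\<sigma> \<in> {\<sigma>. \<sigma> permutes {..<m}}"
      by simp
  next
    fix \<sigma> assume "\<sigma> \<in> {\<sigma>. \<sigma> permutes {..<m}}"
    then have \<sigma>: "\<sigma> permutes {..<m}" by simp
    show "\<sigma> \<in> A n"
      using permutes_subset[OF \<sigma>, of "{..<m + 2}"] permutes_not_in[OF \<sigma>]
      by (auto simp: A_def S_def m_def)
  qed

  have sum_An: "sum T (A n) = \<omega> (w m) (w (m + 1)) * signed_sum \<alpha> \<omega> n w"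
  proof -
    have "sum T (A n) = (\<Sum>\<sigma> | \<sigma> permutes {..<m}. \<omega> (w m) (w (m + 1)) * (of_int (sign \<sigma>) *
        \<alpha> (w (\<sigma> 0)) * (\<Prod>i<n. \<omega> (w (\<sigma> (2 * i + 1))) (w (\<sigma> (2 * i + 2))))))"
    proof (rule sum.cong[OF An], clarsimp simp only: mem_Collect_eq)
      fix \<sigma> assume \<sigma>: "\<sigma> permutes {..<m}"
      have "\<sigma> (2 * n + 1) = m" "\<sigma> (2 * n + 2) = m + 1"
        using permutes_not_in[OF \<sigma>] by (auto simp: m_def)
      then show "T \<sigma> = \<omega> (w m) (w (m + 1)) * (of_int (sign \<sigma>) *
        \<alpha> (w (\<sigma> 0)) * (\<Prod>i<n. \<omega> (w (\<sigma> (2 * i + 1))) (w (\<sigma> (2 * i + 2)))))"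
        by (simp only: T_def prod.lessThan_Suc) (simp only: mult_ac)
    qed
    then show ?thesis
      by (simp only: signed_sum_def m_def sum_distrib_left)
  qed

  have disj: "(A i \<union> B i) \<inter> (A j \<union> B j) = {}" if "i \<noteq> j" for i j
  proof -
    have False if \<sigma>: "\<sigma> \<in> A i \<union> B i" "\<sigma> \<in> A j \<union> B j" for \<sigma>
    proof -
      have "\<sigma> \<in> S" using \<sigma> by (auto simp: A_def B_def)
      moreover have "\<sigma> (2 * i + 1) = \<sigma> (2 * j + 1) \<or> \<sigma> (2 * i + 1) = \<sigma> (2 * j + 2)"
        using \<sigma> by (auto simp: A_def B_def)
      ultimately have "2 * i + 1 = 2 * j + 1 \<or> 2 * i + 1 = 2 * j + 2"
        by (simp only: injS)
      with \<open>i \<noteq> j\<close> show False by presburger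
    qed
    then show ?thesis by blast
  qed

  have "signed_sum \<alpha> \<omega> (Suc n) w = sum T S"
    by (simp add: signed_sum_def T_def S_def m_def del: prod.lessThan_Suc)
  also have "\<dots> = sum T (\<Union>i<Suc n. A i \<union> B i)"
    by (rule sum.mono_neutral_right[OF finS]) (use support in \<open>auto simp: A_def B_def\<close>)
  also have "\<dots> = (\<Sum>i<Suc n. sum T (A i \<union> B i))"
    by (rule sum.UNION_disjoint) (use fin disj in auto)
  also have "\<dots> = (\<Sum>i<Suc n. sum T (A i) + sum T (B i))"
    by (intro sum.cong refl sum.union_disjoint fin) (auto simp: A_def B_def)
  also have "\<dots> = (\<Sum>i<Suc n. 2 * sum T (A n))"
  proof (rule sum.cong[OF refl])
    fix i assume "i \<in> {..<Suc n}"
    then have "sum T (B i) = sum T (A i)" "sum T (A i) = sum T (A n)"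
      using B_eq_A A_eq_An by blast+
    then show "sum T (A i) + sum T (B i) = 2 * sum T (A n)"
      by linarith
  qed
  finally show ?thesis
    unfolding sum_An by (simp add: m_def algebra_simps)
qed

subsection \<open>Double extensions\<close>

lemma alternating_imp_antisym:
  fixes f :: "'a::real_vector \<Rightarrow> 'a \<Rightarrow> 'b::real_vector"
  assumes "bilinear f" "\<And>x. f x x = 0"
  shows "f x y = - f y x"
proof -
  have "f (x + y) (x + y) = f x y + f y x"
    unfolding bilinear_ladd[OF assms(1)] bilinear_radd[OF assms(1)] by (simp add: assms(2))
  then show ?thesis
    by (simp add: assms(2) eq_neg_iff_add_eq_0)
qed

text \<open>Positivity encodes finite dimensionality: a basis of positive cardinality is finite. The
  two bases then make the product an instance of the locale of finite-dimensional products.\<close>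

lemma dim_UNIV_prod:
  assumes "dim (UNIV :: 'a::real_vector set) > 0" "dim (UNIV :: 'b::real_vector set) > 0"
  shows "dim (UNIV :: ('a \<times> 'b) set) = dim (UNIV :: 'a set) + dim (UNIV :: 'b set)"
proof -
  obtain B1 :: "'a set" where B1: "independent B1" "UNIV \<subseteq> span B1" "card B1 = dim (UNIV :: 'a set)"
    using basis_exists[of "UNIV :: 'a set"] by metis
  obtain B2 :: "'b set" where B2: "independent B2" "UNIV \<subseteq> span B2" "card B2 = dim (UNIV :: 'b set)"
    using basis_exists[of "UNIV :: 'b set"] by metis
  have fin: "finite B1" "finite B2"
    using B1(3) B2(3) assms card_ge_0_finite by metis+
  interpret fp: finite_dimensional_vector_space_prod
    "scaleR :: real \<Rightarrow> 'a \<Rightarrow> 'a" "scaleR :: real \<Rightarrow> 'b \<Rightarrow> 'b" B1 B2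
    by unfold_locales
      (use B1 B2 fin in \<open>auto simp: span_raw_def dependent_raw_def\<close>)
  have "real_vector.dim (UNIV \<times> UNIV :: ('a \<times> 'b) set) = dim (UNIV :: 'a set) + dim (UNIV :: 'b set)"
    using fp.dim_Times[of UNIV UNIV]
    unfolding module_prod_scale_eq_scaleR dim_raw_def[symmetric] subspace_raw_def[symmetric]
    by simp
  then show ?thesis
    by simp
qed

text \<open>A family detecting the top form below is prolonged by \<open>ext_d\<close> and
  \<open>ext_e\<close>, which are orthogonal to the embedded vectors and pair to 1. In the surviving
  terms these two occupy slots of \<omega>, so only the values of \<alpha> on embedded vectors
  enter.\<close>

lemma top_form_ext:
  fixes \<alpha>0 :: "'a::real_vector \<Rightarrow> real"
  assumes \<omega>0: "bilinear \<omega>0" "\<And>x. \<omega>0 x x = 0"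
    and \<alpha>: "\<And>x. \<alpha> (ext_in x) = \<alpha>0 x"
    and nz: "wedge 1 (2 * n) (one_form \<alpha>0) (wedge_power \<omega>0 n) \<noteq> (\<lambda>u. 0)"
  shows "wedge 1 (2 * Suc n) (one_form \<alpha>) (wedge_power (ext_form \<omega>0) (Suc n)) \<noteq> (\<lambda>u. 0)"
proof -
  obtain u where u: "signed_sum \<alpha>0 \<omega>0 n u \<noteq> 0"
    using nz unfolding wedge_eq_signed_sum by (auto simp: fun_eq_iff)
  define w where "w = (\<lambda>i. if i < 2 * n + 1 then ext_in (u i)
    else if i = 2 * n + 1 then ext_d else ext_e)"
  note anti = alternating_imp_antisym[OF \<omega>0]
  have "signed_sum \<alpha> (ext_form \<omega>0) (Suc n) w = 2 * (real n + 1) *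
      ext_form \<omega>0 (w (2 * n + 1)) (w (2 * n + 2)) * signed_sum \<alpha> (ext_form \<omega>0) n w"
  proof (rule signed_sum_hyperbolic_pair)
    show "ext_form \<omega>0 X Y = - ext_form \<omega>0 Y X" for X Y
      unfolding ext_form_def by (subst anti) simp
  qed (simp_all add: w_def ext_form_def ext_in_def ext_d_def ext_e_def ext_proj_def
      ext_d_dual_def ext_e_dual_def bilinear_lzero[OF \<omega>0(1)])
  also have "ext_form \<omega>0 (w (2 * n + 1)) (w (2 * n + 2)) = 1"
    by (simp add: w_def ext_form_def ext_d_def ext_e_def ext_proj_def
      ext_d_dual_def ext_e_dual_def bilinear_lzero[OF \<omega>0(1)])
  also have "signed_sum \<alpha> (ext_form \<omega>0) n w = signed_sum \<alpha>0 \<omega>0 n u"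
    unfolding signed_sum_def
  proof (rule sum.cong[OF refl], clarsimp simp only: mem_Collect_eq)
    fix \<sigma> assume \<sigma>: "\<sigma> permutes {..<2 * n + 1}"
    have w: "w (\<sigma> i) = ext_in (u (\<sigma> i))" if "i < 2 * n + 1" for i
      using permutes_in_image[OF \<sigma>, of i] that by (simp add: w_def)
    have "ext_form \<omega>0 (ext_in x) (ext_in y) = \<omega>0 x y" for x y
      by (simp add: ext_form_def ext_in_def ext_proj_def ext_d_dual_def ext_e_dual_def)
    then have "(\<Prod>i<n. ext_form \<omega>0 (w (\<sigma> (2 * i + 1))) (w (\<sigma> (2 * i + 2)))) =
        (\<Prod>i<n. \<omega>0 (u (\<sigma> (2 * i + 1))) (u (\<sigma> (2 * i + 2))))"
      by (intro prod.cong) (simp_all add: w)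
    then show "of_int (sign \<sigma>) * \<alpha> (w (\<sigma> 0)) *
          (\<Prod>i<n. ext_form \<omega>0 (w (\<sigma> (2 * i + 1))) (w (\<sigma> (2 * i + 2)))) =
        of_int (sign \<sigma>) * \<alpha>0 (u (\<sigma> 0)) * (\<Prod>i<n. \<omega>0 (u (\<sigma> (2 * i + 1))) (u (\<sigma> (2 * i + 2))))"
      using w[of 0] by (simp add: \<alpha>)
  qed
  finally have "signed_sum \<alpha> (ext_form \<omega>0) (Suc n) w \<noteq> 0"
    using u by simp
  then show ?thesis
    unfolding wedge_eq_signed_sum fun_eq_iff
    by (intro notI) (metis divide_eq_0_iff power_not_zero zero_neq_numeral)
qed

section \<open>The equivalence of the conditions and the Reeb vector\<close>

theorem theorem3p3:
  fixes br :: "'a::real_vector \<Rightarrow> 'a \<Rightarrow> 'a"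
    and \<alpha>0 :: "'a \<Rightarrow> real" and \<omega>0 :: "'a \<Rightarrow> 'a \<Rightarrow> real"
    and \<xi>0 v :: 'a and \<phi> :: "'a \<Rightarrow> 'a"
    and \<alpha> :: "real \<times> 'a \<times> real \<Rightarrow> real"
  assumes "cosymplectic br \<alpha>0 \<omega>0"
    and "is_reeb_vector \<alpha>0 \<omega>0 \<xi>0"
    and "derivation br \<phi>"
    and "linear \<alpha>"
    and "\<And>x. \<alpha> (ext_in x) = \<alpha>0 x"
    and "\<alpha> ext_e = - 1"
  defines "ebr \<equiv> ext_bracket br \<phi> (\<alpha>0 \<circ> \<phi>) v (\<alpha>0 v)"
    and "\<omega> \<equiv> ext_form \<omega>0"
  shows "(cosymplectic ebr \<alpha> \<omega> \<longleftrightarrow>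
            (\<forall>x y. form_deriv \<omega>0 \<phi> x y = 0) \<and>
            (\<forall>x y. (\<alpha>0 \<circ> \<phi>) (br x y) = 0) \<and>
            v \<in> lie_center br \<inter> form_kernel \<omega>0) \<and>
         (cosymplectic ebr \<alpha> \<omega> \<longrightarrow> is_reeb_vector \<alpha> \<omega> (ext_in \<xi>0))"
proof -
  have br: "bilinear br" "br x x = 0" "br x (br y z) + br y (br z x) + br z (br x y) = 0"
    and \<alpha>0: "linear \<alpha>0" "\<alpha>0 (br x y) = 0"
    and \<omega>0: "bilinear \<omega>0" "\<omega>0 x x = 0"
      "\<omega>0 (br x y) z + \<omega>0 (br y z) x + \<omega>0 (br z x) y = 0" for x y z
    using assms(1) by (auto simp: cosymplectic_def lie_bracket_def)
  obtain n where n: "dim (UNIV :: 'a set) = 2 * n + 1"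
      "wedge 1 (2 * n) (one_form \<alpha>0) (wedge_power \<omega>0 n) \<noteq> (\<lambda>u. 0)"
    using assms(1) by (auto simp: cosymplectic_def)
  have \<phi>: "linear \<phi>" "\<phi> (br x y) = br (\<phi> x) y + br x (\<phi> y)" for x y
    using assms(3) by (auto simp: derivation_def)
  note \<omega>0_anti = alternating_imp_antisym[OF \<omega>0(1,2)]
    and br_anti = alternating_imp_antisym[OF br(1,2)]
  note lins = linear_add linear_diff linear_scale linear_0 linear_neg
  note bils = bilinear_ladd bilinear_radd bilinear_lmul bilinear_rmul bilinear_lzero bilinear_rzero
    bilinear_lneg bilinear_rneg bilinear_lsub bilinear_rsub
  note ext = ext_in_def ext_d_def ext_e_def ext_form_def ext_proj_def ext_d_dual_def ext_e_dual_def

  have \<alpha>_expand: "\<alpha> (s, x, t) = s * \<alpha> ext_d + \<alpha>0 x - t" for s x t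
  proof -
    have "(s, x, t) = s *\<^sub>R ext_d + ext_in x + t *\<^sub>R ext_e"
      by (simp add: ext)
    then show ?thesis
      using assms(4-6) by (simp add: linear_add linear_scale)
  qed
  have ebr: "ebr (s, x, t) (s', x', t') =
     (0, br x x' + s *\<^sub>R \<phi> x' - s' *\<^sub>R \<phi> x + (s * t' - s' * t) *\<^sub>R v,
      s * \<alpha>0 (\<phi> x') - s' * \<alpha>0 (\<phi> x) + (s * t' - s' * t) * \<alpha>0 v)" for s x t s' x' t'
    by (simp add: ebr_def ext_bracket_def)
  have om: "\<omega> (s, x, t) (s', x', t') = \<omega>0 x x' + (s * t' - s' * t)" for s x t s' x' t'
    by (simp add: \<omega>_def ext)
  have dim_ext: "dim (UNIV :: (real \<times> 'a \<times> real) set) = 2 * Suc n + 1"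
    using n(1) by (simp add: dim_UNIV_prod)

  have reeb: "is_reeb_vector \<alpha> \<omega> (ext_in \<xi>0)"
    unfolding is_reeb_vector_def
  proof (intro conjI allI impI)
    show "\<alpha> (ext_in \<xi>0) = 1"
      using assms(2,5) by (simp add: is_reeb_vector_def)
    show "\<omega> (ext_in \<xi>0) Y = 0" for Y
      using assms(2) by (cases Y) (simp add: ext_in_def om is_reeb_vector_def)
    fix Z assume Z: "\<alpha> Z = 1 \<and> (\<forall>Y. \<omega> Z Y = 0)"
    obtain s x t where Zeq: "Z = (s, x, t)" by (cases Z)
    \<comment> \<open>Pairing \<open>Z\<close> with \<open>ext_e\<close> isolates its d-coordinate
      and pairing it with \<open>ext_d\<close> its e-coordinate. What remains is an embedded vector,
      to which uniqueness of \<open>\<xi>0\<close> applies.\<close>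
    have s: "s = 0" using Z om[of s x t 0 0 1] by (simp add: Zeq bils \<omega>0(1))
    have t: "t = 0" using Z om[of s x t 1 0 0] by (simp add: Zeq bils \<omega>0(1))
    have "\<omega>0 x y = 0" for y
      using Z om[of s x t 0 y 0] by (simp add: Zeq s t)
    moreover have "\<alpha>0 x = 1"
      using Z by (simp add: Zeq s t \<alpha>_expand)
    ultimately show "Z = ext_in \<xi>0"
      using assms(2) by (simp add: is_reeb_vector_def Zeq s t ext_in_def)
  qed

  have "cosymplectic ebr \<alpha> \<omega> \<longleftrightarrow>
      (\<forall>x y. form_deriv \<omega>0 \<phi> x y = 0) \<and> (\<forall>x y. (\<alpha>0 \<circ> \<phi>) (br x y) = 0) \<and>
      v \<in> lie_center br \<inter> form_kernel \<omega>0" (is "_ \<longleftrightarrow> ?R")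
  proof
    assume C: "cosymplectic ebr \<alpha> \<omega>"
    then have jac: "ebr X (ebr Y Z) + ebr Y (ebr Z X) + ebr Z (ebr X Y) = 0"
      and clo: "\<omega> (ebr X Y) Z + \<omega> (ebr Y Z) X + \<omega> (ebr Z X) Y = 0" for X Y Z
      unfolding cosymplectic_def lie_bracket_def by blast+
    show ?R
    proof (intro conjI allI IntI)
      fix x y
      \<comment> \<open>In the cocycle identity on x, y, d the term with the bracket of x and y
        vanishes, and the other two make up \<open>form_deriv\<close>.\<close>
      show "form_deriv \<omega>0 \<phi> x y = 0"
        using clo[of "(0, x, 0)" "(0, y, 0)" "(1, 0, 0)"] \<omega>0_anti[of "\<phi> y" x]
        by (simp add: ebr om form_deriv_def lins bils br(1) \<omega>0(1) \<phi>(1) \<alpha>0(1))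
      \<comment> \<open>On x, y, d the middle component of the Jacobi identity expresses the
        derivation property; the e-component is the claim.\<close>
      show "(\<alpha>0 \<circ> \<phi>) (br x y) = 0"
        using jac[of "(0, x, 0)" "(0, y, 0)" "(1, 0, 0)"]
        by (simp add: ebr lins bils br(1) \<phi>(1) \<alpha>0(1) zero_prod_def)
    next
      \<comment> \<open>On x, d, e only the term containing the bracket of d and e survives, both
        here and in the cocycle identity below; it pairs \<open>v\<close> with
        \<open>x\<close>.\<close>
      show "v \<in> lie_center br"
        unfolding lie_center_def
      proof (intro CollectI allI)
        show "br v x = 0" for x
          using jac[of "(0, x, 0)" "(1, 0, 0)" "(0, 0, 1)"] br_anti[of v x]
          by (simp add: ebr lins bils br(1) \<phi>(1) \<alpha>0(1) zero_prod_def)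
      qed
      show "v \<in> form_kernel \<omega>0"
        unfolding form_kernel_def
      proof (intro CollectI allI)
        show "\<omega>0 v x = 0" for x
          using clo[of "(0, x, 0)" "(1, 0, 0)" "(0, 0, 1)"]
          by (simp add: ebr om lins bils br(1) \<omega>0(1) \<phi>(1) \<alpha>0(1))
      qed
    qed
  next
    assume R: ?R
    have R1: "\<omega>0 (\<phi> x) y = - \<omega>0 x (\<phi> y)"
      and R2: "br v x = 0" "br x v = 0"
      and R3: "\<omega>0 v x = 0" "\<omega>0 x v = 0" for x y
      using R br_anti[of x v] \<omega>0_anti[of x v]
      by (auto simp: form_deriv_def lie_center_def form_kernel_def add_eq_0_iff2)
    have \<alpha>\<phi>: "linear (\<alpha>0 \<circ> \<phi>)"
      using linear_compose[OF \<phi>(1) \<alpha>0(1)] .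
    show "cosymplectic ebr \<alpha> \<omega>"
      unfolding cosymplectic_def lie_bracket_def
    proof (intro conjI allI exI[of _ "Suc n"])
      show "bilinear ebr"
        unfolding ebr_def by (rule ext_bracket_bilinear[OF br(1) \<phi>(1) \<alpha>\<phi>])
      show "ebr X X = 0" for X
        unfolding ebr_def by (rule ext_bracket_alternating) (rule br(2))
      show "ebr X (ebr Y Z) + ebr Y (ebr Z X) + ebr Z (ebr X Y) = 0" for X Y Z
      proof (cases X; cases Y; cases Z)
        fix s1 x t1 s2 y t2 s3 z t3
        assume XYZ: "X = (s1, x, t1)" "Y = (s2, y, t2)" "Z = (s3, z, t3)"
        have jac: "br z (br x y) = - br x (br y z) - br y (br z x)"
          using br(3)[of x y z] by (simp add: eq_neg_iff_add_eq_0 algebra_simps)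
        have swap: "br (\<phi> a) b = - br b (\<phi> a)" for a b
          by (rule br_anti)
        \<comment> \<open>Terms of degree two in the d-coordinates cancel cyclically, those of
          degree one by the derivation property, and brackets with \<open>v\<close> vanish. In the
          e-component, \<open>\<phi>\<close> of a bracket is a sum of brackets, on which
          \<open>\<alpha>0\<close> is zero.\<close>
        show ?thesis
          unfolding XYZ ebr
          by (simp add: lins bils br(1) \<phi> \<alpha>0 R2 jac swap zero_prod_def algebra_simps)
      qed
      show "bilinear \<omega>"
        unfolding bilinear_def
        by (intro conjI allI linearI; clarsimp simp: om bils \<omega>0(1) algebra_simps)
      show "\<omega> X X = 0" for X
        by (cases X) (simp add: om \<omega>0(2))
      \<comment> \<open>Brackets have no d-component, and their e-component is
        \<open>\<alpha>0\<close> of the middle component; the value -1 of \<alpha> at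
        \<open>ext_e\<close> makes the two contributions cancel.\<close>
      show "\<alpha> (ebr X Y) = 0" for X Y
        by (cases X; cases Y) (simp add: ebr \<alpha>_expand lins \<alpha>0)
      show "\<omega> (ebr X Y) Z + \<omega> (ebr Y Z) X + \<omega> (ebr Z X) Y = 0" for X Y Z
      proof (cases X; cases Y; cases Z)
        fix s1 x t1 s2 y t2 s3 z t3
        assume XYZ: "X = (s1, x, t1)" "Y = (s2, y, t2)" "Z = (s3, z, t3)"
        \<comment> \<open>The part contributed by the pair d, e cancels cyclically, and the
          coefficient of each remaining d-coordinate is a value of \<open>form_deriv\<close>,
          brought to a common shape by antisymmetry.\<close>
        have "\<omega>0 x (\<phi> y) = - \<omega>0 (\<phi> y) x" for x y
          by (rule \<omega>0_anti)
        then show ?thesis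
          unfolding XYZ ebr om using \<omega>0(3)[of x y z]
            R1[of x y] R1[of y z] R1[of z x]
          by (simp add: lins bils \<omega>0(1) R3 \<alpha>0(1) algebra_simps)
      qed
      show "wedge 1 (2 * Suc n) (one_form \<alpha>) (wedge_power \<omega> (Suc n)) \<noteq> (\<lambda>u. 0)"
        unfolding \<omega>_def by (rule top_form_ext[OF \<omega>0(1,2) assms(5) n(2)])
    qed (use assms(4) dim_ext in auto)
  qed
  with reeb show ?thesis
    by blast
qed

end
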